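(* Consider the problem $\min_{x\in\mathbb{R}^n} f(x)+\lambda p(x)$. The following hold. (i) If $f$ is strongly smooth with constant $L>0$, then a global minimizer $x^*$ is also a $\tau$-stationary point for any $0<\tau<\frac1L$; moreover $x^*=\mathrm{Prox}_{\tau\lambda p(\cdot)}(x^*-\tau\nabla f(x^* ))$, i.e. this set is the singleton $\{x^*\}$. (ii) If $f$ is convex, then a $\tau$-stationary point with $\tau>0$ is a local minimizer. (iii) If $f$ is strongly convex with constant $\ell>0$, then a $\tau$-stationary point with $\tau>1/\ell$ is also a (unique) global minimizer.
   Context: $f:\mathbb{R}^n\to\mathbb{R}$ is twice continuously differentiable and bounded from below, $\lambda>0$, $l,u\in\mathbb{R}^n_+$, $\Omega:=\{x\in\mathbb{R}^n:-l\le x\le u\}$, $\|x\|_0$ is the number of nonzero entries of $x$, and $p(x):=\|x\|_0+\delta_\Omega(x)$, where $\delta_\Omega$ is $0$ on $\Omega$ and $+\infty$ outside. For $\tau>0$, $\mathrm{Prox}_{\tau\lambda p(\cdot)}(z):=\arg\min_{y\in\mathbb{R}^n}\frac12\|y-z\|^2+\tau\lambda p(y)$ (a set), and $x$ is a $\tau$-stationary point if $x\in\mathrm{Prox}_{\tau\lambda p(\cdot)}(x-\tau\nabla f(x))$. Standing assumption on $\tau$ (throughout): $0<\tau<\frac{a}{2\lambda}$, where $a:=\min_{1\le i\le n}\min(l_i^2,u_i^2)$. $f$ is strongly smooth with constant $L>0$ if $f(z)\le f(x)+\langle\nabla f(x),z-x\rangle+\frac L2\|z-x\|^2$ for all $x,z\in\mathbb{R}^n$;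 $f$ is strongly convex with constant $\ell>0$ if $f(z)\ge f(x)+\langle\nabla f(x),z-x\rangle+\frac\ell2\|z-x\|^2$ for all $x,z\in\mathbb{R}^n$. *)

theory Defs
  imports "HOL-Analysis.Analysis"
begin

definition argmin_set :: "('a \<Rightarrow> ereal) \<Rightarrow> 'a set" where
  "argmin_set F = {x. is_arg_min F (\<lambda>_. True) x}"

text \<open>The finiteness requirement matters: without it every point around which \<open>F\<close> is
  identically \<open>\<infinity>\<close> would count as a local minimizer.\<close>

definition local_minimizer :: "('a::topological_space \<Rightarrow> ereal) \<Rightarrow> 'a \<Rightarrow> bool" where
  "local_minimizer F x \<longleftrightarrow> \<bar>F x\<bar> \<noteq> \<infinity> \<and> (\<forall>\<^sub>F y in nhds x. F x \<le> F y)"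

definition prox :: "('a::real_normed_vector \<Rightarrow> ereal) \<Rightarrow> 'a \<Rightarrow> 'a set" where
  "prox \<phi> z = argmin_set (\<lambda>y. ereal (1 / 2 * (norm (y - z))\<^sup>2) + \<phi> y)"

definition gradient :: "('a::real_inner \<Rightarrow> real) \<Rightarrow> 'a \<Rightarrow> 'a" where
  "gradient f x = (THE g. GDERIV f x :> g)"

text \<open>The Hessian is a bounded linear map, and its continuity is with respect to the
  operator norm.\<close>

definition twice_continuously_differentiable :: "('a::euclidean_space \<Rightarrow> real) \<Rightarrow> bool" where
  "twice_continuously_differentiable f \<longleftrightarrow>
     (\<forall>x. f differentiable (at x)) \<and>
     (\<exists>H :: 'a \<Rightarrow> 'a \<Rightarrow>\<^sub>L 'a.
        (\<forall>x. (gradient f has_derivative blinfun_apply (H x)) (at x)) \<and> continuous_on UNIV H)"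

definition strongly_smooth :: "real \<Rightarrow> ('a::real_inner \<Rightarrow> real) \<Rightarrow> bool" where
  "strongly_smooth L f \<longleftrightarrow> L > 0 \<and>
     (\<forall>x z. f z \<le> f x + inner (gradient f x) (z - x) + L / 2 * (norm (z - x))\<^sup>2)"

definition strongly_convex :: "real \<Rightarrow> ('a::real_inner \<Rightarrow> real) \<Rightarrow> bool" where
  "strongly_convex m f \<longleftrightarrow> m > 0 \<and>
     (\<forall>x z. f z \<ge> f x + inner (gradient f x) (z - x) + m / 2 * (norm (z - x))\<^sup>2)"

definition l0_norm :: "real ^ 'n \<Rightarrow> nat" where
  "l0_norm x = card {i. x $ i \<noteq> 0}"

definition indicator_fn :: "'a set \<Rightarrow> 'a \<Rightarrow> ereal" where
  "indicator_fn S x = (if x \<in> S then 0 else \<infinity>)"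

text \<open>The order on vectors is componentwise, so \<open>{- l..u}\<close> is the box.\<close>

definition box_l0 :: "real ^ 'n \<Rightarrow> real ^ 'n \<Rightarrow> real ^ 'n \<Rightarrow> ereal" where
  "box_l0 l u x = ereal (real (l0_norm x)) + indicator_fn {- l..u} x"

definition box_gap :: "real ^ 'n \<Rightarrow> real ^ 'n \<Rightarrow> real" where
  "box_gap l u = (MIN i. min ((l $ i)\<^sup>2) ((u $ i)\<^sup>2))"

definition tau_stationary ::
    "(real ^ 'n \<Rightarrow> real) \<Rightarrow> (real ^ 'n \<Rightarrow> ereal) \<Rightarrow> real \<Rightarrow> real \<Rightarrow> real ^ 'n \<Rightarrow> bool" where
  "tau_stationary f p lam \<tau> x \<longleftrightarrow>
     x \<in> prox (\<lambda>y. ereal (\<tau> * lam) * p y) (x - \<tau> *\<^sub>R gradient f x)"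

end

theory Submission
  imports Defs
begin

text \<open>Expanding the square, \<open>\<tau>\<close>-stationarity of \<open>x\<close> says that \<open>x\<close> minimizes over the box
  \<open>\<langle>\<nabla>f(x), y - x\<rangle> + \<parallel>y - x\<parallel>\<^sup>2 / (2\<tau>) + \<lambda>\<parallel>y\<parallel>\<^sub>0\<close>. Comparing this quadratic model with the upper model
  given by strong smoothness (\<open>L < 1/\<tau>\<close>), or with the lower one given by strong convexity
  (\<open>1/\<tau> < m\<close>), yields (i) and (iii), strictly for \<open>y \<noteq> x\<close>. For (ii), a nearby point of larger support pays at least
  \<open>\<lambda>\<close>, which outweighs the change of \<open>f\<close> by continuity; a nearby point of equal support lies in a feasible
  direction along which the model shows that the slope is nonnegative.\<close>

text \<open>As \<open>c > 0\<close>, the objective is infinite outside the box, but it is finite at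
  \<open>0\<close>, which lies in the box because \<open>l\<close> and \<open>u\<close> are
  nonnegative. So every minimizer lies in the box, and only real values need comparing.\<close>

lemma argmin_set_box_l0_iff:
  fixes l u :: "real ^ 'n"
  assumes "c > 0" "0 \<le> l" "0 \<le> u"
  shows "x \<in> argmin_set (\<lambda>y. ereal (h y) + ereal c * box_l0 l u y) \<longleftrightarrow>
    x \<in> {- l..u} \<and>
    (\<forall>y\<in>{- l..u}. h x + c * real (l0_norm x) \<le> h y + c * real (l0_norm y))"
proof -
  let ?F = "\<lambda>y. ereal (h y) + ereal c * box_l0 l u y"
  have box: "?F y = ereal (h y + c * real (l0_norm y))" if "y \<in> {- l..u}" for y
    using that by (simp add: box_l0_def indicator_fn_def)
  have out: "?F y = \<infinity>" if "y \<notin> {- l..u}" for y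
    using that \<open>c > 0\<close> by (simp add: box_l0_def indicator_fn_def)
  have zero: "0 \<in> {- l..u}"
    using assms by simp
  have min_iff: "x \<in> argmin_set ?F \<longleftrightarrow> (\<forall>y. ?F x \<le> ?F y)"
    by (auto simp: argmin_set_def is_arg_min_def not_less)
  show ?thesis
  proof (cases "x \<in> {- l..u}")
    case True
    then show ?thesis
      unfolding min_iff by (metis box out ereal_less_eq(1,3))
  next
    case False
    then have "\<not> ?F x \<le> ?F 0"
      unfolding out[OF False] box[OF zero] by simp
    with False show ?thesis
      unfolding min_iff by blast
  qed
qed

text \<open>Up to a term independent of \<open>y\<close>, the prox objective is \<tau> times the
  model. The point \<open>w\<close> is kept apart from the centre \<open>x\<close> because the
  singleton claim in (i) concerns all elements of the prox set.\<close>

lemma prox_box_l0_iff: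
  fixes l u :: "real ^ 'n"
  assumes "0 < \<tau>" "0 < lam" "0 \<le> l" "0 \<le> u"
  shows "w \<in> prox (\<lambda>y. ereal (\<tau> * lam) * box_l0 l u y) (x - \<tau> *\<^sub>R g) \<longleftrightarrow>
    w \<in> {- l..u} \<and>
    (\<forall>y\<in>{- l..u}. inner g (w - x) + 1 / (2 * \<tau>) * (norm (w - x))\<^sup>2 + lam * real (l0_norm w)
      \<le> inner g (y - x) + 1 / (2 * \<tau>) * (norm (y - x))\<^sup>2 + lam * real (l0_norm y))"
proof -
  have expand: "1 / 2 * (norm (y - (x - \<tau> *\<^sub>R g)))\<^sup>2 + \<tau> * lam * k =
      1 / 2 * \<tau>\<^sup>2 * (norm g)\<^sup>2
      + \<tau> * (inner g (y - x) + 1 / (2 * \<tau>) * (norm (y - x))\<^sup>2 + lam * k)" for y k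
  proof -
    have "y - (x - \<tau> *\<^sub>R g) = (y - x) + \<tau> *\<^sub>R g"
      by simp
    then show ?thesis
      using \<open>0 < \<tau>\<close>
      by (simp only: power2_norm_eq_inner inner_add_left inner_add_right
            inner_scaleR_left inner_scaleR_right inner_commute[of "y - x" g])
        (simp add: field_simps power2_eq_square)
  qed
  show ?thesis
    unfolding prox_def
    by (subst argmin_set_box_l0_iff) (use assms in \<open>simp_all add: expand del: times_divide_eq_left\<close>)
qed

text \<open>As \<open>gradient\<close> is a definite description, existence and uniqueness are both
  needed. The vector representing the derivative is its adjoint applied to \<open>1\<close>.\<close>

lemma has_gderiv_gradient:
  fixes f :: "'a::euclidean_space \<Rightarrow> real"
  assumes "f differentiable (at x)"
  shows "GDERIV f x :> gradient f x"
proof -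
  obtain f' where f': "(f has_derivative f') (at x)"
    using assms by (auto simp: differentiable_def)
  have "f' = (\<lambda>h. inner h (adjoint f' 1))"
    using adjoint_works[OF has_derivative_linear[OF f'], of _ 1] by (auto simp: fun_eq_iff)
  with f' have ex: "GDERIV f x :> adjoint f' 1"
    by (simp add: gderiv_def)
  have "g = adjoint f' 1" if "GDERIV f x :> g" for g
  proof -
    from that ex have "(\<lambda>h. inner h g) = (\<lambda>h. inner h (adjoint f' 1))"
      unfolding gderiv_def by (rule has_derivative_unique)
    then show ?thesis
      by (simp only: fun_eq_iff vector_eq_ldot)
  qed
  with ex show ?thesis
    unfolding gradient_def by (intro theI[where P = "\<lambda>g. GDERIV f x :> g"])
qed

text \<open>On the line through \<open>x\<close> and \<open>y\<close> this becomes the tangent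
  inequality for a convex function of one variable, taken between 0 and 1.\<close>

lemma convex_on_gradient_ineq:
  fixes f :: "'a::real_inner \<Rightarrow> real"
  assumes "convex_on UNIV f" "GDERIV f x :> g"
  shows "f x + inner g (y - x) \<le> f y"
proof -
  define \<phi> where "\<phi> t = f (x + t *\<^sub>R (y - x))" for t :: real
  have "convex_on UNIV \<phi>"
  proof (rule convex_onI)
    fix t a b :: real assume "0 < t" "t < 1"
    have "x + ((1 - t) *\<^sub>R a + t *\<^sub>R b) *\<^sub>R (y - x)
        = (1 - t) *\<^sub>R (x + a *\<^sub>R (y - x)) + t *\<^sub>R (x + b *\<^sub>R (y - x))"
      by (simp add: algebra_simps)
    then show "\<phi> ((1 - t) *\<^sub>R a + t *\<^sub>R b) \<le> (1 - t) * \<phi> a + t * \<phi> b"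
      unfolding \<phi>_def
      using convex_onD[OF assms(1), of t "x + a *\<^sub>R (y - x)" "x + b *\<^sub>R (y - x)"] \<open>0 < t\<close> \<open>t < 1\<close>
      by simp
  qed simp
  moreover have "(\<phi> has_field_derivative inner g (y - x)) (at 0)"
  proof -
    have "(f has_derivative (\<lambda>h. inner h g)) (at (x + 0 *\<^sub>R (y - x)))"
      using assms(2) by (simp add: gderiv_def)
    then have "(\<phi> has_derivative (\<lambda>t. inner (t *\<^sub>R (y - x)) g)) (at 0)"
      unfolding \<phi>_def
      by (rule has_derivative_compose[rotated]) (auto intro!: derivative_eq_intros)
    then show ?thesis
      by (simp add: has_field_derivative_def inner_commute[of _ g] mult_commute_abs)
  qed
  ultimately have "inner g (y - x) * (1 - 0) \<le> \<phi> 1 - \<phi> 0"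
    by (intro convex_on_imp_above_tangent) auto
  then show ?thesis
    by (simp add: \<phi>_def)
qed

text \<open>Each nonzero coordinate stays nonzero near \<open>x\<close> by continuity, and there are
  finitely many coordinates.\<close>

lemma eventually_support_superset:
  fixes x :: "real ^ 'n"
  shows "\<forall>\<^sub>F y in nhds x. {i. x $ i \<noteq> 0} \<subseteq> {i. y $ i \<noteq> 0}"
proof -
  have "\<forall>\<^sub>F y in nhds x. x $ i \<noteq> 0 \<longrightarrow> y $ i \<noteq> 0" for i
  proof (cases "x $ i = 0")
    case False
    have "((\<lambda>y. y $ i) \<longlongrightarrow> x $ i) (nhds x)"
      by (intro tendsto_vec_nth filterlim_ident)
    then show ?thesis
      using False by (auto dest: tendsto_imp_eventually_ne)
  qed simp
  then have "\<forall>\<^sub>F y in nhds x. \<forall>i. x $ i \<noteq> 0 \<longrightarrow> y $ i \<noteq> 0"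
    by (rule eventually_all_finite)
  then show ?thesis
    by (simp add: subset_eq)
qed

text \<open>Divide by \<open>t\<close> and let \<open>t\<close> tend to 0 from the right.\<close>

lemma nonneg_of_scaled_quadratic:
  fixes a b :: real
  assumes "\<And>t. 0 < t \<Longrightarrow> t < 1 \<Longrightarrow> 0 \<le> t * a + t\<^sup>2 * b"
  shows "0 \<le> a"
proof -
  have "((\<lambda>t. a + t * b) \<longlongrightarrow> a + 0 * b) (at_right 0)"
    by (intro tendsto_intros)
  moreover have "\<forall>\<^sub>F t in at_right (0::real). 0 \<le> a + t * b"
    unfolding eventually_at_right_field
  proof (intro exI[of _ 1] conjI allI impI)
    fix t :: real assume t: "0 < t" "t < 1"
    with assms[of t] have "0 \<le> t * (a + t * b)"
      by (simp add: algebra_simps power2_eq_square)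
    with t show "0 \<le> a + t * b"
      by (simp add: zero_le_mult_iff)
  qed simp
  ultimately have "0 \<le> a + 0 * b"
    by (rule tendsto_lowerbound) simp
  then show ?thesis
    by simp
qed

text \<open>The coefficient \<open>c\<close> is arbitrary, since the quadratic term disappears in
  the limit along a segment.\<close>

lemma local_minimizer_of_model_minimizer:
  fixes f :: "real ^ 'n \<Rightarrow> real" and l u :: "real ^ 'n"
  assumes convex: "convex_on UNIV f" and deriv: "GDERIV f x :> g"
    and lam_pos: "0 < lam"
    and x_box: "x \<in> {- l..u}"
    and model: "\<And>y. y \<in> {- l..u} \<Longrightarrow>
      lam * real (l0_norm x) \<le> inner g (y - x) + c * (norm (y - x))\<^sup>2 + lam * real (l0_norm y)"
  shows "local_minimizer (\<lambda>x. ereal (f x) + ereal lam * box_l0 l u x) x"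
proof -
  let ?F = "\<lambda>x. ereal (f x) + ereal lam * box_l0 l u x"
  have box: "?F y = ereal (f y + lam * real (l0_norm y))" if "y \<in> {- l..u}" for y
    using that by (simp add: box_l0_def indicator_fn_def)
  have out: "?F y = \<infinity>" if "y \<notin> {- l..u}" for y
    using that lam_pos by (simp add: box_l0_def indicator_fn_def)
  have "isCont f x"
    using deriv by (simp add: gderiv_def has_derivative_continuous)
  then have "(f \<longlongrightarrow> f x) (nhds x)"
    by (simp add: isCont_def tendsto_at_iff_tendsto_nhds)
  \<comment> \<open>The margin \<open>lam\<close> is the price of one additional nonzero
    entry.\<close>
  then have "\<forall>\<^sub>F y in nhds x. f x - lam < f y"
    by (rule order_tendstoD(1)) (simp add: lam_pos)
  then have "\<forall>\<^sub>F y in nhds x. ?F x \<le> ?F y"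
    using eventually_support_superset[of x]
  proof eventually_elim
    case (elim y)
    show ?case
    proof (cases "y \<in> {- l..u}")
      case y_box: True
      have "f x + lam * real (l0_norm x) \<le> f y + lam * real (l0_norm y)"
      proof (cases "{i. x $ i \<noteq> 0} = {i. y $ i \<noteq> 0}")
        case True
        then have supp: "x $ i = 0 \<longleftrightarrow> y $ i = 0" for i
          by blast
        \<comment> \<open>Apply the model inequality at a point \<open>w\<close> of the segment from
          \<open>x\<close> to \<open>y\<close>, which stays in the box.\<close>
        have "0 \<le> t * inner g (y - x) + t\<^sup>2 * (c * (norm (y - x))\<^sup>2)"
          if t: "0 < t" "t < 1" for t
        proof -
          define w where "w = x + t *\<^sub>R (y - x)"
          have w_eq: "w = (1 - t) *\<^sub>R x + t *\<^sub>R y"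
            by (simp add: w_def algebra_simps)
          have "w \<in> {- l..u}"
            unfolding w_eq using x_box y_box t
            by (intro convexD) (auto simp: convex_closed_interval)
          \<comment> \<open>Only an inequality: entries of \<open>x\<close> and \<open>y\<close>
            with opposite signs may cancel in \<open>w\<close>.\<close>
          moreover have "l0_norm w \<le> l0_norm x"
            unfolding l0_norm_def w_eq by (intro card_mono) (auto simp: supp)
          then have "lam * real (l0_norm w) \<le> lam * real (l0_norm x)"
            using lam_pos by simp
          ultimately have "0 \<le> inner g (w - x) + c * (norm (w - x))\<^sup>2"
            using model[of w] by linarith
          then show ?thesis
            by (simp add: w_def power_mult_distrib mult.left_commute)
        qed
        then have "0 \<le> inner g (y - x)"
          by (rule nonneg_of_scaled_quadratic)
        then have "f x \<le> f y"
          using convex_on_gradient_ineq[OF convex deriv, of y] by linarith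
        then show ?thesis
          by (simp add: l0_norm_def True)
      next
        case False
        with elim have "l0_norm x < l0_norm y"
          unfolding l0_norm_def by (intro psubset_card_mono) auto
        \<comment> \<open>Cardinalities are integers, so a strictly larger support costs at least
          one more \<open>lam\<close>.\<close>
        then have "lam * (real (l0_norm x) + 1) \<le> lam * real (l0_norm y)"
          using lam_pos by (intro mult_left_mono) auto
        with elim show ?thesis
          by (simp add: algebra_simps)
      qed
      then show ?thesis
        unfolding box[OF x_box] box[OF y_box] by simp
    next
      case False
      show ?thesis
        unfolding out[OF False] by simp
    qed
  qed
  then show ?thesis
    unfolding local_minimizer_def box[OF x_box] by simp
qed

theorem proposition3:
  fixes f :: "real ^ 'n \<Rightarrow> real"
    and l u :: "real ^ 'n"
    and lam \<tau> :: real
  defines "p \<equiv> box_l0 l u"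
  defines "F \<equiv> (\<lambda>x. ereal (f x) + ereal lam * p x)"
  assumes f_C2: "twice_continuously_differentiable f"
    and f_bdd: "bdd_below (range f)"
    and lam_pos: "lam > 0"
    and l_nonneg: "0 \<le> l"
    and u_nonneg: "0 \<le> u"
    and tau_pos: "0 < \<tau>"
    and tau_less: "\<tau> < box_gap l u / (2 * lam)"
  shows "(\<forall>L x. strongly_smooth L f \<and> \<tau> < 1 / L \<and> x \<in> argmin_set F \<longrightarrow>
            tau_stationary f p lam \<tau> x \<and>
            prox (\<lambda>y. ereal (\<tau> * lam) * p y) (x - \<tau> *\<^sub>R gradient f x) = {x})
       \<and> (\<forall>x. convex_on UNIV f \<and> tau_stationary f p lam \<tau> x \<longrightarrow> local_minimizer F x)
       \<and> (\<forall>m x. strongly_convex m f \<and> \<tau> > 1 / m \<and> tau_stationary f p lam \<tau> x \<longrightarrow>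
            argmin_set F = {x})"
proof (intro conjI allI impI; elim conjE)
  have argmin_iff: "w \<in> argmin_set F \<longleftrightarrow> w \<in> {- l..u} \<and>
      (\<forall>y\<in>{- l..u}. f w + lam * real (l0_norm w) \<le> f y + lam * real (l0_norm y))" for w
    unfolding F_def p_def by (rule argmin_set_box_l0_iff[OF lam_pos l_nonneg u_nonneg])
  note prox_iff = prox_box_l0_iff[OF tau_pos lam_pos l_nonneg u_nonneg, folded p_def]
  {
    fix L x
    assume smooth: "strongly_smooth L f" and "\<tau> < 1 / L" and min: "x \<in> argmin_set F"
    let ?P = "prox (\<lambda>y. ereal (\<tau> * lam) * p y) (x - \<tau> *\<^sub>R gradient f x)"
    have "L / 2 < 1 / (2 * \<tau>)"
      using smooth \<open>\<tau> < 1 / L\<close> tau_pos by (simp add: strongly_smooth_def field_simps)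
    \<comment> \<open>The left side is the model at \<open>x\<close>. Minimality together with
      smoothness gives the bound with coefficient \<open>L / 2\<close>; raising it to
      \<open>1 / (2 * \<tau>)\<close> is strict as \<open>y \<noteq> x\<close>.\<close>
    have strict: "lam * real (l0_norm x) < inner (gradient f x) (y - x)
        + 1 / (2 * \<tau>) * (norm (y - x))\<^sup>2 + lam * real (l0_norm y)"
      if "y \<in> {- l..u}" "y \<noteq> x" for y
    proof -
      have "f x + lam * real (l0_norm x) \<le> f y + lam * real (l0_norm y)"
        using min that by (simp add: argmin_iff)
      moreover have "f y \<le> f x + inner (gradient f x) (y - x) + L / 2 * (norm (y - x))\<^sup>2"
        using smooth by (simp add: strongly_smooth_def)
      moreover have "L / 2 * (norm (y - x))\<^sup>2 < 1 / (2 * \<tau>) * (norm (y - x))\<^sup>2"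
        using \<open>L / 2 < 1 / (2 * \<tau>)\<close> that by (intro mult_strict_right_mono) auto
      ultimately show ?thesis
        by linarith
    qed
    have x_box: "x \<in> {- l..u}"
      using min by (simp only: argmin_iff)
    have "x \<in> ?P"
      unfolding prox_iff using x_box strict by (force intro: less_imp_le)
    \<comment> \<open>A prox point \<open>w\<close> has a model value at most that of
      \<open>x\<close>, which \<open>strict\<close> excludes for
      \<open>w \<noteq> x\<close>.\<close>
    moreover have "w = x" if "w \<in> ?P" for w
      using that strict[of w] x_box unfolding prox_iff by force
    ultimately show "?P = {x}" and "tau_stationary f p lam \<tau> x"
      unfolding tau_stationary_def by blast+
  next
    fix x
    assume convex: "convex_on UNIV f" and "tau_stationary f p lam \<tau> x"
    then have "x \<in> {- l..u}" and "\<And>y. y \<in> {- l..u} \<Longrightarrow>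
        lam * real (l0_norm x) \<le> inner (gradient f x) (y - x)
          + 1 / (2 * \<tau>) * (norm (y - x))\<^sup>2 + lam * real (l0_norm y)"
      unfolding tau_stationary_def prox_iff by auto
    moreover have "GDERIV f x :> gradient f x"
      using f_C2 by (simp add: twice_continuously_differentiable_def has_gderiv_gradient)
    ultimately show "local_minimizer F x"
      unfolding F_def p_def using convex lam_pos
      by (intro local_minimizer_of_model_minimizer)
  next
    fix m x
    assume sc: "strongly_convex m f" and "1 / m < \<tau>" and "tau_stationary f p lam \<tau> x"
    then have x_box: "x \<in> {- l..u}" and model: "\<And>y. y \<in> {- l..u} \<Longrightarrow>
        lam * real (l0_norm x) \<le> inner (gradient f x) (y - x)
          + 1 / (2 * \<tau>) * (norm (y - x))\<^sup>2 + lam * real (l0_norm y)"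
      unfolding tau_stationary_def prox_iff by auto
    have "1 / (2 * \<tau>) < m / 2"
      using sc \<open>1 / m < \<tau>\<close> tau_pos by (simp add: strongly_convex_def field_simps)
    \<comment> \<open>Now the roles are reversed: stationarity supplies the model inequality and
      strong convexity bounds \<open>f y\<close> from below. Strictness gives uniqueness.\<close>
    have strict: "f x + lam * real (l0_norm x) < f y + lam * real (l0_norm y)"
      if "y \<in> {- l..u}" "y \<noteq> x" for y
    proof -
      have "f x + inner (gradient f x) (y - x) + m / 2 * (norm (y - x))\<^sup>2 \<le> f y"
        using sc by (simp add: strongly_convex_def)
      moreover have "1 / (2 * \<tau>) * (norm (y - x))\<^sup>2 < m / 2 * (norm (y - x))\<^sup>2"
        using \<open>1 / (2 * \<tau>) < m / 2\<close> that by (intro mult_strict_right_mono) auto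
      ultimately show ?thesis
        using model[OF that(1)] by linarith
    qed
    have "x \<in> argmin_set F"
      unfolding argmin_iff using x_box strict by (force intro: less_imp_le)
    moreover have "w = x" if "w \<in> argmin_set F" for w
      using that strict[of w] x_box unfolding argmin_iff by force
    ultimately show "argmin_set F = {x}"
      by blast
  }
qed

end
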